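(* Let $P=(X,\prec)$ be a finite poset. Let $A,B\subseteq X$ be lower ideals and let $C,D\subseteq X$ be upper ideals of $P$ such that $A\cap C=B\cap D=\varnothing$. Set $V:=(A\cap B)\cup(C\cup D)$ and $W:=(A\cup B)\cup(C\cap D)$. Then $$f(X\setminus V)\cdot f(X\setminus W)\ \ge\ f(X\setminus(A\cup C))\cdot f(X\setminus(B\cup D)).$$
   Context: For a finite poset $(Y,\prec)$ with $|Y|=m$, a linear extension is a bijection $L:Y\to\{1,\dots,m\}$ with $L(x)<L(y)$ whenever $x\prec y$; $e(Y)$ is the number of linear extensions, and $f(Y):=e(Y)/|Y|!$ (so $f(\varnothing)=1$). For a subset $Y\subseteq X$, $e(Y)$ and $f(Y)$ refer to the induced subposet $(Y,\prec)$. A subset $A\subseteq X$ is a lower ideal if $x\in A$ and $y\prec x$ imply $y\in A$; it is an upper ideal if $x\in A$ and $y\succ x$ imply $y\in A$. *)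

theory Defs
  imports Complex_Main "HOL-Library.FuncSet"
begin

text \<open>
  A poset is given by a carrier \<open>X\<close> and its strict order \<open>lt\<close>; outside \<open>X\<close> the relation is
  unconstrained. The induced subposet on \<open>Y \<subseteq> X\<close> is \<open>(Y, lt)\<close> with the same \<open>lt\<close>.
\<close>

definition finite_poset :: "'a set \<Rightarrow> ('a \<Rightarrow> 'a \<Rightarrow> bool) \<Rightarrow> bool" where
  "finite_poset X lt \<longleftrightarrow> finite X \<and> irreflp_on X lt \<and> transp_on X lt"

definition lower_ideal :: "'a set \<Rightarrow> ('a \<Rightarrow> 'a \<Rightarrow> bool) \<Rightarrow> 'a set \<Rightarrow> bool" where
  "lower_ideal X lt A \<longleftrightarrow> A \<subseteq> X \<and> (\<forall>x\<in>A. \<forall>y\<in>X. lt y x \<longrightarrow> y \<in> A)"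

definition upper_ideal :: "'a set \<Rightarrow> ('a \<Rightarrow> 'a \<Rightarrow> bool) \<Rightarrow> 'a set \<Rightarrow> bool" where
  "upper_ideal X lt A \<longleftrightarrow> A \<subseteq> X \<and> (\<forall>x\<in>A. \<forall>y\<in>X. lt x y \<longrightarrow> y \<in> A)"

text \<open>
  Extensionality (value \<open>undefined\<close> off \<open>Y\<close>) makes each bijection on \<open>Y\<close> be counted
  exactly once.
\<close>

definition linear_extensions :: "'a set \<Rightarrow> ('a \<Rightarrow> 'a \<Rightarrow> bool) \<Rightarrow> ('a \<Rightarrow> nat) set" where
  "linear_extensions Y lt =
     {L \<in> extensional Y. bij_betw L Y {1..card Y} \<and>
        (\<forall>x\<in>Y. \<forall>y\<in>Y. lt x y \<longrightarrow> L x < L y)}"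

definition num_linear_extensions :: "'a set \<Rightarrow> ('a \<Rightarrow> 'a \<Rightarrow> bool) \<Rightarrow> nat" where
  "num_linear_extensions Y lt = card (linear_extensions Y lt)"

definition linext_density :: "'a set \<Rightarrow> ('a \<Rightarrow> 'a \<Rightarrow> bool) \<Rightarrow> real" where
  "linext_density Y lt = real (num_linear_extensions Y lt) / fact (card Y)"

end

theory Submission
  imports Defs "HOL-Library.Infinite_Set"
begin

text \<open>
  The density \<open>f(Y) = e(Y) / |Y|!\<close> is the limiting probability that a uniformly random map from \<open>Y\<close> to a
  long chain preserves the order: as \<open>t\<close> grows, almost every map \<open>Y \<rightarrow> {1..t}\<close> is injective, and an
  injective order-preserving map is a linear extension of \<open>Y\<close> together with the choice of its
  \<open>|Y|\<close> values. Hence \<open>f(Y)\<close> is the limit of \<open>\<Omega>(Y, t) / t^|Y|\<close>, where \<open>\<Omega>(Y, t)\<close> counts the weakly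
  order-preserving maps \<open>Y \<rightarrow> {1..t}\<close> (\<open>linext_density_asymptotic\<close>). Since
  \<open>|A \<union> C| + |B \<union> D| = |V| + |W|\<close>, the powers of \<open>t\<close> on the two sides of the theorem agree, and it
  is enough to prove the inequality with \<open>\<Omega>(_, t)\<close> in place of \<open>f\<close> for each \<open>t\<close>
  (\<open>order_preserving_maps_correlation\<close>).

  To compare posets with different ground sets, the missing elements are put back. An
  order-preserving map on \<open>X - (A \<union> C)\<close> is the same thing as an order-preserving map
  \<open>X \<rightarrow> {0..t+1}\<close> that takes the bottom value \<open>0\<close> exactly on the lower ideal \<open>A\<close> and the top value
  \<open>t + 1\<close> exactly on the upper ideal \<open>C\<close> (\<open>card_clamped_maps\<close>). If \<open>f\<close> is clamped by \<open>(A, C)\<close> and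
  \<open>g\<close> by \<open>(B, D)\<close>, then their pointwise maximum is clamped by \<open>(A \<inter> B, C \<union> D)\<close> and their pointwise
  minimum by \<open>(A \<union> B, C \<inter> D)\<close>, which are the pairs that define \<open>V\<close> and \<open>W\<close>.

  The inequality thus becomes \<open>|F| |G| \<le> |F \<or> G| |F \<and> G|\<close> for families \<open>F, G\<close> in the distributive
  lattice of functions from \<open>X\<close> to a chain (\<open>card_max_min_families\<close>). This is Daykin's inequality, a
  consequence of the four functions theorem of Ahlswede and Daykin, which is proved here for the
  power set of a finite set (\<open>four_functions\<close>); a function into a chain becomes a set by passing to
  the region below its graph.
\<close>

section \<open>The four functions theorem on a finite power set\<close>

text \<open>
  The case of a one-element ground set. Both mixed products are bounded by the same number
  \<open>P = c1 * d0\<close>, while their own product is bounded by \<open>P * Q\<close> with \<open>Q = c0 * d1\<close>; two numbers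
  below \<open>P\<close> whose product is at most \<open>P * Q\<close> have sum at most \<open>P + Q\<close>.
\<close>

lemma four_functions_two_point:
  fixes a0 a1 b0 b1 c0 c1 d0 d1 :: real
  assumes nonneg: "0 \<le> a0" "0 \<le> a1" "0 \<le> b0" "0 \<le> b1" "0 \<le> c0" "0 \<le> c1" "0 \<le> d0" "0 \<le> d1"
    and h00: "a0 * b0 \<le> c0 * d0" and h01: "a0 * b1 \<le> c1 * d0"
    and h10: "a1 * b0 \<le> c1 * d0" and h11: "a1 * b1 \<le> c1 * d1"
  shows "(a0 + a1) * (b0 + b1) \<le> (c0 + c1) * (d0 + d1)"
proof -
  define P Q where "P = c1 * d0" and "Q = c0 * d1"
  have mixed: "a0 * b1 + a1 * b0 \<le> P + Q"
  proof (cases "P = 0")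
    case True
    have "0 \<le> Q" using nonneg by (simp add: Q_def)
    moreover have "a0 * b1 \<le> P" "a1 * b0 \<le> P" using h01 h10 by (simp_all add: P_def)
    ultimately show ?thesis using True by linarith
  next
    case False
    then have P: "0 < P" using nonneg by (simp add: P_def less_le)
    have "(a0 * b0) * (a1 * b1) \<le> (c0 * d0) * (c1 * d1)"
      using nonneg by (intro mult_mono h00 h11) auto
    then have prod_le: "(a0 * b1) * (a1 * b0) \<le> P * Q"
      by (simp add: P_def Q_def mult_ac)
    have "0 \<le> (P - a0 * b1) * (P - a1 * b0)"
      using h01 h10 by (simp add: P_def)
    then have "P * (a0 * b1 + a1 * b0) \<le> P * P + (a0 * b1) * (a1 * b0)"
      by (simp add: algebra_simps)
    also have "\<dots> \<le> P * (P + Q)"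
      using prod_le by (simp add: algebra_simps)
    finally show ?thesis using P by simp
  qed
  then show ?thesis
    using h00 h11 by (simp add: P_def Q_def algebra_simps)
qed

lemma sum_Pow_insert:
  fixes f :: "'b set \<Rightarrow> 'c :: comm_monoid_add"
  assumes "finite U" "u \<notin> U"
  shows "sum f (Pow (insert u U)) = (\<Sum>S\<in>Pow U. f S + f (insert u S))"
proof -
  have "sum f (Pow (insert u U)) = sum f (Pow U) + sum f (insert u ` Pow U)"
    unfolding Pow_insert using assms by (intro sum.union_disjoint) auto
  also have "sum f (insert u ` Pow U) = (\<Sum>S\<in>Pow U. f (insert u S))"
    using assms(2) by (subst sum.reindex) (auto simp: inj_on_def)
  finally show ?thesis by (simp add: sum.distrib)
qed

text \<open>
  Induction on the ground set. Summing a new point \<open>u\<close> out, that is, replacing each function \<open>\<alpha>\<close> by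
  \<open>S \<mapsto> \<alpha> S + \<alpha> (insert u S)\<close>, keeps the total sum over the power set, and the two-point case
  shows that it also keeps the pointwise hypothesis. It is this step that needs arbitrary
  weights even when one only wants to count sets.
\<close>

lemma four_functions:
  fixes \<alpha> \<beta> \<gamma> \<delta> :: "'b set \<Rightarrow> real"
  assumes "finite U"
    and "\<And>S. S \<subseteq> U \<Longrightarrow> 0 \<le> \<alpha> S \<and> 0 \<le> \<beta> S \<and> 0 \<le> \<gamma> S \<and> 0 \<le> \<delta> S"
    and "\<And>S T. S \<subseteq> U \<Longrightarrow> T \<subseteq> U \<Longrightarrow> \<alpha> S * \<beta> T \<le> \<gamma> (S \<union> T) * \<delta> (S \<inter> T)"
  shows "sum \<alpha> (Pow U) * sum \<beta> (Pow U) \<le> sum \<gamma> (Pow U) * sum \<delta> (Pow U)"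
  using assms
proof (induction U arbitrary: \<alpha> \<beta> \<gamma> \<delta> rule: finite_induct)
  case empty
  then show ?case by simp
next
  case (insert u U)
  have nonneg: "0 \<le> \<alpha> S" "0 \<le> \<beta> S" "0 \<le> \<gamma> S" "0 \<le> \<delta> S"
      "0 \<le> \<alpha> (insert u S)" "0 \<le> \<beta> (insert u S)" "0 \<le> \<gamma> (insert u S)" "0 \<le> \<delta> (insert u S)"
    if "S \<subseteq> U" for S
    using insert.prems(1)[of S] insert.prems(1)[of "insert u S"] that by auto
  show ?case
    unfolding sum_Pow_insert[OF insert.hyps]
  proof (rule insert.IH)
    fix S assume "S \<subseteq> U"
    then show "0 \<le> \<alpha> S + \<alpha> (insert u S) \<and> 0 \<le> \<beta> S + \<beta> (insert u S) \<and>
        0 \<le> \<gamma> S + \<gamma> (insert u S) \<and> 0 \<le> \<delta> S + \<delta> (insert u S)"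
      by (simp add: nonneg)
  next
    fix S T assume ST: "S \<subseteq> U" "T \<subseteq> U"
    have u: "u \<notin> S" "u \<notin> T" using ST insert.hyps by auto
    have sub: "S \<union> T \<subseteq> U" "S \<inter> T \<subseteq> U" using ST by auto
    show "(\<alpha> S + \<alpha> (insert u S)) * (\<beta> T + \<beta> (insert u T))
        \<le> (\<gamma> (S \<union> T) + \<gamma> (insert u (S \<union> T))) * (\<delta> (S \<inter> T) + \<delta> (insert u (S \<inter> T)))"
    proof (rule four_functions_two_point)
      show "\<alpha> S * \<beta> T \<le> \<gamma> (S \<union> T) * \<delta> (S \<inter> T)"
        using insert.prems(2)[of S T] ST by blast
      show "\<alpha> S * \<beta> (insert u T) \<le> \<gamma> (insert u (S \<union> T)) * \<delta> (S \<inter> T)"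
        using insert.prems(2)[of S "insert u T"] ST u by (simp add: subset_insertI2 insert_mono)
      show "\<alpha> (insert u S) * \<beta> T \<le> \<gamma> (insert u (S \<union> T)) * \<delta> (S \<inter> T)"
        using insert.prems(2)[of "insert u S" T] ST u by (simp add: subset_insertI2 insert_mono)
      show "\<alpha> (insert u S) * \<beta> (insert u T)
          \<le> \<gamma> (insert u (S \<union> T)) * \<delta> (insert u (S \<inter> T))"
        using insert.prems(2)[of "insert u S" "insert u T"] ST u
        by (simp add: subset_insertI2 insert_mono)
    qed (use nonneg ST sub in auto)
  qed
qed

text \<open>
  The four functions theorem for indicator functions.
\<close>

lemma card_union_inter_families:
  fixes \<A> \<B> \<C> \<D> :: "'b set set"
  assumes U: "finite U" and sub: "\<A> \<subseteq> Pow U" "\<B> \<subseteq> Pow U" "\<C> \<subseteq> Pow U" "\<D> \<subseteq> Pow U"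
    and un: "\<And>S T. S \<in> \<A> \<Longrightarrow> T \<in> \<B> \<Longrightarrow> S \<union> T \<in> \<C>"
    and int: "\<And>S T. S \<in> \<A> \<Longrightarrow> T \<in> \<B> \<Longrightarrow> S \<inter> T \<in> \<D>"
  shows "card \<A> * card \<B> \<le> card \<C> * card \<D>"
proof -
  have indicator_sum: "(\<Sum>S\<in>Pow U. if S \<in> \<F> then 1 else 0 :: real) = card \<F>"
    if "\<F> \<subseteq> Pow U" for \<F> :: "'b set set"
  proof -
    have "Pow U \<inter> \<F> = \<F>" using that by auto
    then show ?thesis using U by (simp add: sum.If_cases)
  qed
  have "(\<Sum>S\<in>Pow U. if S \<in> \<A> then 1 else 0 :: real) * (\<Sum>S\<in>Pow U. if S \<in> \<B> then 1 else 0)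
      \<le> (\<Sum>S\<in>Pow U. if S \<in> \<C> then 1 else 0) * (\<Sum>S\<in>Pow U. if S \<in> \<D> then 1 else 0)"
    by (rule four_functions[OF U]) (use un int in auto)
  then have "real (card \<A> * card \<B>) \<le> real (card \<C> * card \<D>)"
    by (simp add: indicator_sum sub)
  then show ?thesis by (simp only: of_nat_le_iff)
qed

section \<open>Families of functions into a chain\<close>

text \<open>
  An embedding of the lattice of functions from \<open>X\<close> to a chain into a power set: pointwise maximum
  and minimum become union and intersection.
\<close>

definition subgraph_set :: "'a set \<Rightarrow> ('a \<Rightarrow> nat) \<Rightarrow> ('a \<times> nat) set" where
  "subgraph_set X h = {(x, i). x \<in> X \<and> i < h x}"

lemma inj_on_subgraph_set: "inj_on (subgraph_set X) (extensional X)"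
proof (rule inj_onI)
  fix f g :: "'a \<Rightarrow> nat"
  assume ext: "f \<in> extensional X" "g \<in> extensional X"
    and eq: "subgraph_set X f = subgraph_set X g"
  show "f = g"
  proof (rule extensionalityI[OF ext])
    fix x assume x: "x \<in> X"
    have "i < f x \<longleftrightarrow> i < g x" for i
      using eq x by (auto simp: subgraph_set_def set_eq_iff)
    then show "f x = g x" by (meson less_irrefl linorder_neqE_nat)
  qed
qed

lemma card_max_min_families:
  fixes F G H K :: "('a \<Rightarrow> nat) set"
  assumes X: "finite X"
    and sub: "F \<subseteq> X \<rightarrow>\<^sub>E {..m}" "G \<subseteq> X \<rightarrow>\<^sub>E {..m}" "H \<subseteq> X \<rightarrow>\<^sub>E {..m}" "K \<subseteq> X \<rightarrow>\<^sub>E {..m}"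
    and mx: "\<And>f g. f \<in> F \<Longrightarrow> g \<in> G \<Longrightarrow> (\<lambda>x\<in>X. max (f x) (g x)) \<in> H"
    and mn: "\<And>f g. f \<in> F \<Longrightarrow> g \<in> G \<Longrightarrow> (\<lambda>x\<in>X. min (f x) (g x)) \<in> K"
  shows "card F * card G \<le> card H * card K"
proof -
  let ?s = "subgraph_set X"
  have card_eq: "card (?s ` E) = card E" if "E \<subseteq> X \<rightarrow>\<^sub>E {..m}" for E
    using that by (intro card_image inj_on_subset[OF inj_on_subgraph_set]) (auto simp: PiE_def)
  have bounded: "?s ` E \<subseteq> Pow (X \<times> {..<m})" if "E \<subseteq> X \<rightarrow>\<^sub>E {..m}" for E
  proof -
    have "h x \<le> m" if "h \<in> E" "x \<in> X" for h x
      using that \<open>E \<subseteq> _\<close> by (auto dest: PiE_mem)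
    then show ?thesis by (fastforce simp: subgraph_set_def)
  qed
  have un: "?s f \<union> ?s g = ?s (\<lambda>x\<in>X. max (f x) (g x))" for f g
    by (auto simp: subgraph_set_def)
  have int: "?s f \<inter> ?s g = ?s (\<lambda>x\<in>X. min (f x) (g x))" for f g
    by (auto simp: subgraph_set_def)
  have "card (?s ` F) * card (?s ` G) \<le> card (?s ` H) * card (?s ` K)"
  proof (rule card_union_inter_families[where U = "X \<times> {..<m}"])
    fix S T assume "S \<in> ?s ` F" "T \<in> ?s ` G"
    then show "S \<union> T \<in> ?s ` H" and "S \<inter> T \<in> ?s ` K"
      using mx mn by (auto simp: un int)
  qed (use X bounded sub in auto)
  then show ?thesis by (simp add: card_eq sub)
qed

section \<open>Order-preserving maps and clamped maps\<close>

definition order_preserving_maps :: "'a set \<Rightarrow> ('a \<Rightarrow> 'a \<Rightarrow> bool) \<Rightarrow> nat \<Rightarrow> ('a \<Rightarrow> nat) set" where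
  "order_preserving_maps Y lt t =
     {h \<in> Y \<rightarrow>\<^sub>E {1..t}. \<forall>x\<in>Y. \<forall>y\<in>Y. lt x y \<longrightarrow> h x \<le> h y}"

text \<open>
  The two equivalences make \<open>A\<close> and \<open>C\<close> the whole preimages of the bottom and top values, so that
  on the rest of \<open>X\<close> the values lie in \<open>{1..t}\<close>.
\<close>

definition clamped_maps ::
  "'a set \<Rightarrow> ('a \<Rightarrow> 'a \<Rightarrow> bool) \<Rightarrow> 'a set \<Rightarrow> 'a set \<Rightarrow> nat \<Rightarrow> ('a \<Rightarrow> nat) set" where
  "clamped_maps X lt A C t =
     {h \<in> X \<rightarrow>\<^sub>E {..Suc t}. (\<forall>x\<in>X. \<forall>y\<in>X. lt x y \<longrightarrow> h x \<le> h y) \<and>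
        (\<forall>x\<in>X. (h x = 0 \<longleftrightarrow> x \<in> A) \<and> (h x = Suc t \<longleftrightarrow> x \<in> C))}"

text \<open>
  Restriction to \<open>X - (A \<union> C)\<close> is a bijection. Its inverse fills in \<open>0\<close> on \<open>A\<close> and \<open>t + 1\<close> on \<open>C\<close>;
  the filled-in map preserves the order because nothing outside \<open>A\<close> lies below an element of \<open>A\<close>
  and nothing outside \<open>C\<close> lies above an element of \<open>C\<close>.
\<close>

lemma card_clamped_maps:
  assumes A: "lower_ideal X lt A" and C: "upper_ideal X lt C" and AC: "A \<inter> C = {}"
  shows "card (clamped_maps X lt A C t) = card (order_preserving_maps (X - (A \<union> C)) lt t)"
proof -
  let ?Y = "X - (A \<union> C)"
  define extend where
    "extend h = (\<lambda>x\<in>X. if x \<in> A then 0 else if x \<in> C then Suc t else h x)" for h :: "'a \<Rightarrow> nat"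
  have AX: "A \<subseteq> X" and Adown: "\<And>x y. x \<in> A \<Longrightarrow> y \<in> X \<Longrightarrow> lt y x \<Longrightarrow> y \<in> A"
    using A by (auto simp: lower_ideal_def)
  have CX: "C \<subseteq> X" and Cup: "\<And>x y. x \<in> C \<Longrightarrow> y \<in> X \<Longrightarrow> lt x y \<Longrightarrow> y \<in> C"
    using C by (auto simp: upper_ideal_def)
  have "bij_betw (\<lambda>h. restrict h ?Y) (clamped_maps X lt A C t) (order_preserving_maps ?Y lt t)"
  proof (rule bij_betw_byWitness[where f' = extend])
    show "\<forall>h\<in>clamped_maps X lt A C t. extend (restrict h ?Y) = h"
    proof
      fix h assume h: "h \<in> clamped_maps X lt A C t"
      show "extend (restrict h ?Y) = h"
      proof (rule extensionalityI[where A = X])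
        show "extend (restrict h ?Y) \<in> extensional X" by (simp add: extend_def)
        show "h \<in> extensional X" using h by (simp add: clamped_maps_def PiE_def)
        show "extend (restrict h ?Y) x = h x" if "x \<in> X" for x
          using h that by (auto simp: extend_def clamped_maps_def)
      qed
    qed
    show "\<forall>h\<in>order_preserving_maps ?Y lt t. restrict (extend h) ?Y = h"
    proof
      fix h assume h: "h \<in> order_preserving_maps ?Y lt t"
      show "restrict (extend h) ?Y = h"
      proof (rule extensionalityI[where A = ?Y])
        show "h \<in> extensional ?Y" using h by (simp add: order_preserving_maps_def PiE_def)
      qed (auto simp: extend_def)
    qed
    show "(\<lambda>h. restrict h ?Y) ` clamped_maps X lt A C t \<subseteq> order_preserving_maps ?Y lt t"
    proof (rule image_subsetI)
      fix h assume h: "h \<in> clamped_maps X lt A C t"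
      have "h x \<in> {1..t}" if "x \<in> ?Y" for x
      proof -
        have "h x \<le> Suc t" "h x \<noteq> 0" "h x \<noteq> Suc t"
          using h that by (auto simp: clamped_maps_def dest: PiE_mem)
        then show ?thesis by simp
      qed
      then show "restrict h ?Y \<in> order_preserving_maps ?Y lt t"
        using h by (auto simp: order_preserving_maps_def clamped_maps_def)
    qed
    show "extend ` order_preserving_maps ?Y lt t \<subseteq> clamped_maps X lt A C t"
    proof (rule image_subsetI)
      fix h assume h: "h \<in> order_preserving_maps ?Y lt t"
      have rng: "1 \<le> h x" "h x \<le> t" if "x \<in> X" "x \<notin> A" "x \<notin> C" for x
        using h that by (auto simp: order_preserving_maps_def dest!: PiE_mem)
      have mono: "h x \<le> h y"
        if "x \<in> X" "x \<notin> A" "x \<notin> C" "y \<in> X" "y \<notin> A" "y \<notin> C" "lt x y" for x y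
        using h that by (auto simp: order_preserving_maps_def)
      have "extend h \<in> X \<rightarrow>\<^sub>E {..Suc t}"
        using rng(2) by (auto simp: extend_def le_SucI)
      moreover have "extend h x \<le> extend h y" if "x \<in> X" "y \<in> X" "lt x y" for x y
        using that Adown[of y x] Cup[of x y] rng(2)[of x] mono[of x y] AC
        by (auto simp: extend_def)
      moreover have "(extend h x = 0 \<longleftrightarrow> x \<in> A) \<and> (extend h x = Suc t \<longleftrightarrow> x \<in> C)"
        if "x \<in> X" for x
        using that rng[of x] AC by (auto simp: extend_def)
      ultimately show "extend h \<in> clamped_maps X lt A C t"
        by (simp add: clamped_maps_def)
    qed
  qed
  then show ?thesis by (rule bij_betw_same_card)
qed

text \<open>
  A maximum is \<open>0\<close> iff both values are, and is \<open>t + 1\<close> iff one of them is; dually for a minimum. So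
  maxima and minima of clamped maps are clamped by the ideals on the right-hand side, which are
  again disjoint pairs, and Daykin's inequality applies.
\<close>

lemma order_preserving_maps_correlation:
  fixes X A B C D :: "'a set"
  assumes X: "finite X"
    and A: "lower_ideal X lt A" and B: "lower_ideal X lt B"
    and C: "upper_ideal X lt C" and D: "upper_ideal X lt D"
    and AC: "A \<inter> C = {}" and BD: "B \<inter> D = {}"
  shows "card (order_preserving_maps (X - (A \<union> C)) lt t)
           * card (order_preserving_maps (X - (B \<union> D)) lt t)
         \<le> card (order_preserving_maps (X - (A \<inter> B \<union> (C \<union> D))) lt t)
           * card (order_preserving_maps (X - (A \<union> B \<union> C \<inter> D)) lt t)"
proof -
  let ?M = "\<lambda>A C. clamped_maps X lt A C t"
  have "card (?M A C) * card (?M B D) \<le> card (?M (A \<inter> B) (C \<union> D)) * card (?M (A \<union> B) (C \<inter> D))"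
  proof (rule card_max_min_families[OF X])
    show "?M A C \<subseteq> X \<rightarrow>\<^sub>E {..Suc t}" "?M B D \<subseteq> X \<rightarrow>\<^sub>E {..Suc t}"
      "?M (A \<inter> B) (C \<union> D) \<subseteq> X \<rightarrow>\<^sub>E {..Suc t}" "?M (A \<union> B) (C \<inter> D) \<subseteq> X \<rightarrow>\<^sub>E {..Suc t}"
      by (simp_all add: clamped_maps_def)
  next
    fix f g assume f: "f \<in> ?M A C" and g: "g \<in> ?M B D"
    have bound: "f x \<le> Suc t" "g x \<le> Suc t" if "x \<in> X" for x
      using f g that by (auto simp: clamped_maps_def dest: PiE_mem)
    have clamp: "f x = 0 \<longleftrightarrow> x \<in> A" "f x = Suc t \<longleftrightarrow> x \<in> C"
        "g x = 0 \<longleftrightarrow> x \<in> B" "g x = Suc t \<longleftrightarrow> x \<in> D" if "x \<in> X" for x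
      using f g that by (auto simp: clamped_maps_def)
    have mono: "f x \<le> f y" "g x \<le> g y" if "x \<in> X" "y \<in> X" "lt x y" for x y
      using f g that by (auto simp: clamped_maps_def)
    have join: "max (f x) (g x) \<le> Suc t" "max (f x) (g x) = 0 \<longleftrightarrow> x \<in> A \<inter> B"
        "max (f x) (g x) = Suc t \<longleftrightarrow> x \<in> C \<union> D" if "x \<in> X" for x
      unfolding Int_iff Un_iff clamp[OF that, symmetric] using bound[OF that] by linarith+
    have join_mono: "max (f x) (g x) \<le> max (f y) (g y)" if "x \<in> X" "y \<in> X" "lt x y" for x y
      using mono[OF that] by linarith
    show "(\<lambda>x\<in>X. max (f x) (g x)) \<in> ?M (A \<inter> B) (C \<union> D)"
      unfolding clamped_maps_def using join join_mono by (simp del: Int_iff Un_iff)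
    have meet: "min (f x) (g x) \<le> Suc t" "min (f x) (g x) = 0 \<longleftrightarrow> x \<in> A \<union> B"
        "min (f x) (g x) = Suc t \<longleftrightarrow> x \<in> C \<inter> D" if "x \<in> X" for x
      unfolding Int_iff Un_iff clamp[OF that, symmetric] using bound[OF that] by linarith+
    have meet_mono: "min (f x) (g x) \<le> min (f y) (g y)" if "x \<in> X" "y \<in> X" "lt x y" for x y
      using mono[OF that] by linarith
    show "(\<lambda>x\<in>X. min (f x) (g x)) \<in> ?M (A \<union> B) (C \<inter> D)"
      unfolding clamped_maps_def using meet meet_mono by (simp del: Int_iff Un_iff min_le_iff_disj)
  qed
  moreover have "lower_ideal X lt (A \<inter> B)" "lower_ideal X lt (A \<union> B)"
    using A B by (auto simp: lower_ideal_def)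
  moreover have "upper_ideal X lt (C \<inter> D)" "upper_ideal X lt (C \<union> D)"
    using C D by (auto simp: upper_ideal_def)
  moreover have "A \<inter> B \<inter> (C \<union> D) = {}" "(A \<union> B) \<inter> (C \<inter> D) = {}"
    using AC BD by auto
  ultimately show ?thesis
    using A B C D AC BD by (simp add: card_clamped_maps)
qed

section \<open>Asymptotics of the number of order-preserving maps\<close>

text \<open>
  Relabelling along the increasing bijection \<open>{1..|Y|} \<rightarrow> K\<close>: any set of \<open>|Y|\<close> labels gives
  the same count as \<open>{1..|Y|}\<close>.
\<close>

lemma card_linear_extensions_onto:
  fixes K :: "nat set"
  assumes Y: "finite Y" and K: "finite K" "card K = card Y"
  shows "card {h \<in> extensional Y. bij_betw h Y K \<and> (\<forall>x\<in>Y. \<forall>y\<in>Y. lt x y \<longrightarrow> h x < h y)}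
         = num_linear_extensions Y lt"
proof -
  let ?R = "{h \<in> extensional Y. bij_betw h Y K \<and> (\<forall>x\<in>Y. \<forall>y\<in>Y. lt x y \<longrightarrow> h x < h y)}"
  obtain e0 where e0: "bij_betw e0 {..<card K} K" "strict_mono_on {..<card K} e0"
    using ex_bij_betw_strict_mono_card[OF K(1)] by blast
  \<comment> \<open>linear extensions number from 1, the enumeration \<open>e0\<close> from 0\<close>
  define e where "e i = e0 (i - 1)" for i
  have "bij_betw (\<lambda>i. i - 1 :: nat) {1..card Y} {..<card Y}"
    by (rule bij_betw_byWitness[where f' = Suc]) auto
  then have "bij_betw (e0 \<circ> (\<lambda>i. i - 1)) {1..card Y} K"
    using e0(1) K(2) by (auto intro: bij_betw_trans)
  then have e_bij: "bij_betw e {1..card Y} K"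
    by (simp add: comp_def e_def[abs_def])
  have e_less: "e i < e j \<longleftrightarrow> i < j" if "i \<in> {1..card Y}" "j \<in> {1..card Y}" for i j
  proof -
    have *: "e i < e j" if "i \<in> {1..card Y}" "j \<in> {1..card Y}" "i < j" for i j
      using that strict_mono_onD[OF e0(2), of "i - 1" "j - 1"] K(2) by (auto simp: e_def)
    show ?thesis using *[of i j] *[of j i] that by (metis less_asym linorder_neqE_nat less_irrefl)
  qed
  define d where "d = inv_into {1..card Y} e"
  have d_bij: "bij_betw d K {1..card Y}"
    unfolding d_def by (rule bij_betw_inv_into[OF e_bij])
  have ed: "e (d k) = k" if "k \<in> K" for k
    using e_bij that unfolding d_def by (simp add: bij_betw_inv_into_right)
  have de: "d (e i) = i" if "i \<in> {1..card Y}" for i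
    using e_bij that unfolding d_def by (simp add: bij_betw_inv_into_left)
  have dK: "d k \<in> {1..card Y}" if "k \<in> K" for k
    using d_bij that by (rule bij_betwE[rule_format])
  have "bij_betw (\<lambda>L. \<lambda>y\<in>Y. e (L y)) (linear_extensions Y lt) ?R"
  proof (rule bij_betw_byWitness[where f' = "\<lambda>h. \<lambda>y\<in>Y. d (h y)"])
    show "\<forall>L\<in>linear_extensions Y lt. (\<lambda>y\<in>Y. d ((\<lambda>y\<in>Y. e (L y)) y)) = L"
    proof
      fix L assume "L \<in> linear_extensions Y lt"
      then have L: "L \<in> extensional Y" "bij_betw L Y {1..card Y}"
        by (auto simp: linear_extensions_def)
      show "(\<lambda>y\<in>Y. d ((\<lambda>y\<in>Y. e (L y)) y)) = L"
        by (rule extensionalityI[OF _ L(1)]) (use bij_betwE[OF L(2)] in \<open>auto intro!: de\<close>)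
    qed
    show "\<forall>h\<in>?R. (\<lambda>y\<in>Y. e ((\<lambda>y\<in>Y. d (h y)) y)) = h"
    proof
      fix h assume h: "h \<in> ?R"
      show "(\<lambda>y\<in>Y. e ((\<lambda>y\<in>Y. d (h y)) y)) = h"
        by (rule extensionalityI[where A = Y])
          (use h in \<open>auto intro!: ed dest: bij_betwE\<close>)
    qed
    show "(\<lambda>L. \<lambda>y\<in>Y. e (L y)) ` linear_extensions Y lt \<subseteq> ?R"
    proof (rule image_subsetI)
      fix L assume "L \<in> linear_extensions Y lt"
      then have L: "bij_betw L Y {1..card Y}" "\<And>x y. x \<in> Y \<Longrightarrow> y \<in> Y \<Longrightarrow> lt x y \<Longrightarrow> L x < L y"
        by (auto simp: linear_extensions_def)
      have "bij_betw (e \<circ> L) Y K" using L(1) e_bij by (rule bij_betw_trans)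
      then have "bij_betw (\<lambda>y\<in>Y. e (L y)) Y K"
        by (rule bij_betw_cong[THEN iffD1, rotated]) simp
      then show "(\<lambda>y\<in>Y. e (L y)) \<in> ?R"
        using L bij_betwE[OF L(1)] by (auto simp: e_less)
    qed
    show "(\<lambda>h. \<lambda>y\<in>Y. d (h y)) ` ?R \<subseteq> linear_extensions Y lt"
    proof (rule image_subsetI)
      fix h assume "h \<in> ?R"
      then have h: "bij_betw h Y K" "\<And>x y. x \<in> Y \<Longrightarrow> y \<in> Y \<Longrightarrow> lt x y \<Longrightarrow> h x < h y"
        by auto
      have hK: "h x \<in> K" if "x \<in> Y" for x using bij_betwE[OF h(1)] that by blast
      have "bij_betw (d \<circ> h) Y {1..card Y}" using h(1) d_bij by (rule bij_betw_trans)
      then have "bij_betw (\<lambda>y\<in>Y. d (h y)) Y {1..card Y}"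
        by (rule bij_betw_cong[THEN iffD1, rotated]) simp
      moreover have "d (h x) < d (h y)" if "x \<in> Y" "y \<in> Y" "lt x y" for x y
        using h(2)[OF that] e_less[OF dK dK, OF hK hK, OF that(1,2)] that
        by (simp add: ed hK)
      ultimately show "(\<lambda>y\<in>Y. d (h y)) \<in> linear_extensions Y lt"
        by (auto simp: linear_extensions_def)
    qed
  qed
  then show ?thesis
    by (simp add: num_linear_extensions_def bij_betw_same_card)
qed

text \<open>
  The injective maps are sorted by their image, an arbitrary \<open>|Y|\<close>-subset of \<open>{1..t}\<close>.
  Irreflexivity is what turns weak into strict inequalities for an injective map.
\<close>

lemma card_injective_order_preserving_maps:
  assumes Y: "finite Y" and irr: "irreflp_on Y lt"
  shows "card {h \<in> order_preserving_maps Y lt t. inj_on h Y}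
         = (t choose card Y) * num_linear_extensions Y lt"
proof -
  let ?S = "\<lambda>K. {h \<in> extensional Y. bij_betw h Y K \<and> (\<forall>x\<in>Y. \<forall>y\<in>Y. lt x y \<longrightarrow> h x < h y)}"
  let ?\<K> = "{K. K \<subseteq> {1..t} \<and> card K = card Y}"
  have strict: "h x < h y"
    if "inj_on h Y" "\<forall>x\<in>Y. \<forall>y\<in>Y. lt x y \<longrightarrow> h x \<le> h y" "x \<in> Y" "y \<in> Y" "lt x y"
    for h :: "'a \<Rightarrow> nat" and x y
  proof -
    have "x \<noteq> y" using irr that by (auto simp: irreflp_on_def)
    then have "h x \<noteq> h y" using that by (auto dest: inj_onD)
    then show ?thesis using that by (auto simp: less_le)
  qed
  have eq: "{h \<in> order_preserving_maps Y lt t. inj_on h Y} = (\<Union>K\<in>?\<K>. ?S K)"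
  proof (intro equalityI subsetI)
    fix h assume h: "h \<in> {h \<in> order_preserving_maps Y lt t. inj_on h Y}"
    then have "h ` Y \<in> ?\<K>"
      by (auto simp: order_preserving_maps_def card_image dest: PiE_mem)
    moreover have "h \<in> ?S (h ` Y)"
      using h strict[of h] by (auto simp: order_preserving_maps_def PiE_def bij_betw_def)
    ultimately show "h \<in> (\<Union>K\<in>?\<K>. ?S K)" by blast
  next
    fix h assume "h \<in> (\<Union>K\<in>?\<K>. ?S K)"
    then obtain K where K: "K \<subseteq> {1..t}" "h \<in> ?S K" by auto
    then have "h ` Y \<subseteq> {1..t}" by (auto simp: bij_betw_def)
    then show "h \<in> {h \<in> order_preserving_maps Y lt t. inj_on h Y}"
      using K(2) by (auto simp: order_preserving_maps_def bij_betw_def PiE_def intro: less_imp_le)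
  qed
  have fin: "finite (?S K)" if "K \<subseteq> {1..t}" for K
  proof (rule finite_subset)
    show "?S K \<subseteq> Y \<rightarrow>\<^sub>E {1..t}" using that by (auto simp: bij_betw_def PiE_def)
    show "finite (Y \<rightarrow>\<^sub>E {1..t})" using Y by (intro finite_PiE) auto
  qed
  have "card (\<Union>K\<in>?\<K>. ?S K) = (\<Sum>K\<in>?\<K>. card (?S K))"
  proof (rule card_UN_disjoint)
    show "finite ?\<K>" by (rule finite_subset[of _ "Pow {1..t}"]) auto
    show "\<forall>K\<in>?\<K>. finite (?S K)" using fin by blast
    show "\<forall>K\<in>?\<K>. \<forall>L\<in>?\<K>. K \<noteq> L \<longrightarrow> ?S K \<inter> ?S L = {}" by (auto simp: bij_betw_def)
  qed
  also have "\<dots> = (\<Sum>K\<in>?\<K>. num_linear_extensions Y lt)"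
    using Y by (intro sum.cong refl card_linear_extensions_onto) (auto intro: finite_subset)
  also have "\<dots> = (t choose card Y) * num_linear_extensions Y lt"
    by (simp add: n_subsets)
  finally show ?thesis by (simp add: eq)
qed

lemma binomial_over_power_tendsto:
  "(\<lambda>t. real (t choose k) / real t ^ k) \<longlonglongrightarrow> 1 / fact k"
proof -
  have "(\<lambda>t. (\<Prod>i=0..<k. 1 - real i / real t) / fact k) \<longlonglongrightarrow> (\<Prod>i=0..<k. 1 - 0) / fact k"
    by (intro tendsto_divide tendsto_prod tendsto_diff tendsto_const lim_const_over_n) auto
  moreover have "\<forall>\<^sub>F t in sequentially.
      (\<Prod>i=0..<k. 1 - real i / real t) / fact k = real (t choose k) / real t ^ k"
    using eventually_gt_at_top[of 0]
  proof eventually_elim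
    case (elim t)
    have "(\<Prod>i=0..<k. 1 - real i / real t) = (\<Prod>i=0..<k. (real t - real i) / real t)"
      using elim by (intro prod.cong) (auto simp: diff_divide_distrib)
    also have "\<dots> = (\<Prod>i=0..<k. real t - real i) / real t ^ k"
      by (simp add: prod_dividef)
    finally show ?case
      by (simp add: binomial_gbinomial gbinomial_prod_rev)
  qed
  ultimately show ?thesis by (simp add: tendsto_cong)
qed

text \<open>
  A squeeze between the number of injective order-preserving maps and the same number plus the
  number of all non-injective maps \<open>Y \<rightarrow> {1..t}\<close>. The latter is
  \<open>t^|Y| - |Y|! * (t choose |Y|)\<close>, which is negligible against \<open>t^|Y|\<close>.
\<close>

lemma linext_density_asymptotic:
  assumes Y: "finite Y" and irr: "irreflp_on Y lt"
  shows "(\<lambda>t. real (card (order_preserving_maps Y lt t)) / real t ^ card Y)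
           \<longlonglongrightarrow> linext_density Y lt"
proof -
  let ?k = "card Y" and ?e = "real (num_linear_extensions Y lt)"
  let ?b = "\<lambda>t. real (t choose ?k) / real t ^ ?k"
  have injs: "real (card {h \<in> Y \<rightarrow>\<^sub>E {1..t}. inj_on h Y}) = fact ?k * (t choose ?k)" for t
  proof -
    have "card {h \<in> Y \<rightarrow>\<^sub>E {1..t}. inj_on h Y} = (\<Prod>i=0..<?k. t - i)"
      using card_inj_on_subset_funcset[OF Y, of "{1..t}" Y] by simp
    also have "real \<dots> = (\<Prod>i=0..<?k. real t - real i)"
    \<comment> \<open>truncated and real subtraction differ when \<open>t < ?k\<close>, but then both products have a factor 0\<close>
    proof (cases "?k \<le> t")
      case True
      then show ?thesis by (simp add: of_nat_diff)
    next
      case False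
      then have "t \<in> {0..<?k}" by simp
      then have "(\<Prod>i=0..<?k. t - i) = 0" "(\<Prod>i=0..<?k. real t - real i) = 0"
        by (intro prod_zero finite_atLeastLessThan bexI[of _ t]; simp)+
      then show ?thesis by (simp only: of_nat_0)
    qed
    also have "\<dots> = fact ?k * (t choose ?k)"
      by (simp add: binomial_gbinomial gbinomial_prod_rev)
    finally show ?thesis .
  qed
  have lower: "?e * (t choose ?k) \<le> card (order_preserving_maps Y lt t)" 
    and upper: "card (order_preserving_maps Y lt t)
       \<le> ?e * (t choose ?k) + (real t ^ ?k - fact ?k * (t choose ?k))" for t
  proof -
    let ?M = "order_preserving_maps Y lt t" and ?F = "Y \<rightarrow>\<^sub>E {1..t}"
    let ?I = "{h \<in> ?M. inj_on h Y}" and ?J = "{h \<in> ?F. inj_on h Y}"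
    have fin: "finite ?F" using Y by (intro finite_PiE) auto
    have MF: "?M \<subseteq> ?F" by (auto simp: order_preserving_maps_def)
    have finM: "finite ?M" using MF fin by (rule finite_subset)
    have cI: "real (card ?I) = ?e * (t choose ?k)"
      by (simp add: card_injective_order_preserving_maps[OF Y irr])
    have "card ?I \<le> card ?M" by (rule card_mono[OF finM]) auto
    then show "?e * (t choose ?k) \<le> card ?M" using cI by simp
    have "card ?M \<le> card (?I \<union> (?F - ?J))"
      using fin finM MF by (intro card_mono) auto
    also have "\<dots> \<le> card ?I + card (?F - ?J)" by (rule card_Un_le)
    finally have "real (card ?M) \<le> real (card ?I) + real (card (?F - ?J))" by simp
    moreover have "real (card (?F - ?J)) = real (card ?F) - real (card ?J)"
      using fin by (subst card_Diff_subset) (auto intro: finite_subset of_nat_diff card_mono)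
    ultimately show "card ?M \<le> ?e * (t choose ?k) + (real t ^ ?k - fact ?k * (t choose ?k))"
      using Y by (simp add: cI injs card_funcsetE del: One_nat_def)
  qed
  have lim_lower: "(\<lambda>t. ?e * ?b t) \<longlonglongrightarrow> linext_density Y lt"
    using tendsto_mult[OF tendsto_const[of ?e] binomial_over_power_tendsto[of ?k]]
    by (simp add: linext_density_def)
  have "(\<lambda>t. ?e * ?b t + (1 - fact ?k * ?b t))
      \<longlonglongrightarrow> linext_density Y lt + (1 - fact ?k * (1 / fact ?k))"
    by (intro tendsto_add lim_lower tendsto_diff tendsto_mult tendsto_const
        binomial_over_power_tendsto)
  then have lim_upper: "(\<lambda>t. ?e * ?b t + (1 - fact ?k * ?b t)) \<longlonglongrightarrow> linext_density Y lt"
    by simp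
  show ?thesis
  proof (rule tendsto_sandwich[OF _ _ lim_lower lim_upper])
    show "\<forall>\<^sub>F t in sequentially. ?e * ?b t \<le> real (card (order_preserving_maps Y lt t)) / real t ^ ?k"
      using lower by (auto intro!: always_eventually simp: divide_right_mono)
    show "\<forall>\<^sub>F t in sequentially. real (card (order_preserving_maps Y lt t)) / real t ^ ?k
        \<le> ?e * ?b t + (1 - fact ?k * ?b t)"
      using eventually_gt_at_top[of 0]
    proof eventually_elim
      case (elim t)
      have "real (card (order_preserving_maps Y lt t)) / real t ^ ?k
          \<le> (?e * (t choose ?k) + (real t ^ ?k - fact ?k * (t choose ?k))) / real t ^ ?k"
        by (rule divide_right_mono[OF upper]) simp
      also have "\<dots> = ?e * ?b t + (1 - fact ?k * ?b t)"
        using elim by (simp add: add_divide_distrib diff_divide_distrib)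
      finally show ?case .
    qed
  qed
qed

section \<open>The correlation inequality for linear extensions\<close>

theorem theorem3p4:
  fixes X A B C D V W :: "'a set" and lt :: "'a \<Rightarrow> 'a \<Rightarrow> bool"
  assumes "finite_poset X lt"
    and "lower_ideal X lt A" and "lower_ideal X lt B"
    and "upper_ideal X lt C" and "upper_ideal X lt D"
    and "A \<inter> C = {}" and "B \<inter> D = {}"
    and "V = (A \<inter> B) \<union> (C \<union> D)"
    and "W = (A \<union> B) \<union> (C \<inter> D)"
  shows "linext_density (X - V) lt * linext_density (X - W) lt
           \<ge> linext_density (X - (A \<union> C)) lt * linext_density (X - (B \<union> D)) lt"
proof -
  let ?c = "\<lambda>Y t. real (card (order_preserving_maps Y lt t))"
  have X: "finite X" and irr: "irreflp_on X lt"
    using assms(1) by (auto simp: finite_poset_def)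
  have sub: "A \<subseteq> X" "B \<subseteq> X" "C \<subseteq> X" "D \<subseteq> X"
    using assms(2-5) by (auto simp: lower_ideal_def upper_ideal_def)
  have lim: "(\<lambda>t. (?c (X - S) t / real t ^ card (X - S)) * (?c (X - T) t / real t ^ card (X - T)))
      \<longlonglongrightarrow> linext_density (X - S) lt * linext_density (X - T) lt" for S T
    using X irr
    by (intro tendsto_mult linext_density_asymptotic) (auto simp: irreflp_on_def)
  \<comment> \<open>both sides are divided by the same power of \<open>t\<close>\<close>
  have degree: "card (X - (A \<union> C)) + card (X - (B \<union> D)) = card (X - V) + card (X - W)"
  proof -
    have fin: "finite A" "finite B" "finite C" "finite D"
      using X sub by (auto intro: finite_subset)
    have VW: "V \<subseteq> X" "W \<subseteq> X" using sub assms(8,9) by auto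
    have co: "card (X - S) + card S = card X" if "S \<subseteq> X" for S
      using X that by (simp add: card_Diff_subset finite_subset card_mono)
    have "card (A \<union> C) = card A + card C" "card (B \<union> D) = card B + card D"
      using fin assms(6,7) by (simp_all add: card_Un_disjoint)
    moreover have "card V = card (A \<inter> B) + card (C \<union> D)"
      unfolding assms(8) using fin assms(6,7) by (intro card_Un_disjoint) auto
    moreover have "card W = card (A \<union> B) + card (C \<inter> D)"
      unfolding assms(9) using fin assms(6,7) by (intro card_Un_disjoint) auto
    moreover have "card A + card B = card (A \<union> B) + card (A \<inter> B)"
      "card C + card D = card (C \<union> D) + card (C \<inter> D)"
      by (rule card_Un_Int[OF fin(1,2)], rule card_Un_Int[OF fin(3,4)])
    ultimately show ?thesis
      using co[of "A \<union> C"] co[of "B \<union> D"] co[OF VW(1)] co[OF VW(2)] sub by simp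
  qed
  show ?thesis
  proof (rule LIMSEQ_le[OF lim lim])
    have "(?c (X - (A \<union> C)) t / real t ^ card (X - (A \<union> C)))
          * (?c (X - (B \<union> D)) t / real t ^ card (X - (B \<union> D)))
        \<le> (?c (X - V) t / real t ^ card (X - V)) * (?c (X - W) t / real t ^ card (X - W))" for t
    proof -
      have "?c (X - (A \<union> C)) t * ?c (X - (B \<union> D)) t \<le> ?c (X - V) t * ?c (X - W) t"
        unfolding assms(8,9) of_nat_mult[symmetric] of_nat_le_iff
        by (rule order_preserving_maps_correlation[OF X assms(2-7)])
      then show ?thesis
        unfolding times_divide_times_eq power_add[symmetric] degree
        by (rule divide_right_mono) simp
    qed
    then show "\<exists>N. \<forall>t\<ge>N. (?c (X - (A \<union> C)) t / real t ^ card (X - (A \<union> C)))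
          * (?c (X - (B \<union> D)) t / real t ^ card (X - (B \<union> D)))
        \<le> (?c (X - V) t / real t ^ card (X - V)) * (?c (X - W) t / real t ^ card (X - W))"
      by blast
  qed
qed

end
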